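(* Let $u \in \mathcal{W}_2$ be a word of length $n$ with exactly one $1$, and let $i$ be the index of that $1$. Then $u$ is in $\mathcal{U}(\{0, 1\})$ if and only if $\binom{n-1}{i-1}$ is odd.
   Context: $\mathcal{W}_2$ is the set of finite nonempty binary strings (words on the alphabet $\{0,1\}$), with multiplication $*$ given by concatenation; the size of a word is its length. The Ulam set $\mathcal{U}(\{0,1\})\subset\mathcal{W}_2$ is built as follows: first put the one-letter words $0$ and $1$ into it; then repeatedly add a shortest word not already in the set that can be written in exactly one way as a concatenation $v*w$ of two distinct words $v\neq w$ already in the set (representations are ordered pairs $(v,w)$). Ties among words of the same length may be broken arbitrarily without affecting the resulting set. Equivalently, a word $u$ of length at least $2$ is in $\mathcal{U}(\{0,1\})$ iff there is exactly one ordered pair $(v,w)$ of distinct elements of $\mathcal{U}(\{0,1\})$ with $u=v*w$. The index of a letter in a word is the number of letters to its left, including the letter itself (so indices run from $1$ to $n$). *)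

theory Defs
  imports Main
begin

text \<open>
  Binary words are lists over \<^typ>\<open>bool\<close>, with \<^term>\<open>False\<close> for the letter 0 and
  \<^term>\<open>True\<close> for the letter 1; the product of words is \<^term>\<open>(@)\<close>.
\<close>

definition words2 :: "bool list set" where
  "words2 = {u. u \<noteq> []}"

definition ulam_candidate :: "bool list set \<Rightarrow> bool list \<Rightarrow> bool" where
  "ulam_candidate A u \<longleftrightarrow> u \<notin> A \<and>
     (\<exists>!p. fst p \<in> A \<and> snd p \<in> A \<and> fst p \<noteq> snd p \<and> u = fst p @ snd p)"

text \<open>
  One step adds a single shortest candidate. It is a relation because several candidates may have
  the same length. If there is no candidate the set stays as it is; this never happens for the
  generators 0 and 1, but does for one generator.
\<close>

definition ulam_step :: "bool list set \<Rightarrow> bool list set \<Rightarrow> bool" where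
  "ulam_step A B \<longleftrightarrow>
     (if \<exists>u. ulam_candidate A u
      then \<exists>u. ulam_candidate A u \<and> (\<forall>w. ulam_candidate A w \<longrightarrow> length u \<le> length w) \<and> B = insert u A
      else B = A)"

definition ulam_run :: "bool list set \<Rightarrow> (nat \<Rightarrow> bool list set) \<Rightarrow> bool" where
  "ulam_run G S \<longleftrightarrow> S 0 = G \<and> (\<forall>k. ulam_step (S k) (S (Suc k)))"

text \<open>
  Ties are broken by the choice of a run. For the generators 0 and 1 the choice does not matter,
  see \<open>ulam_run_Union\<close> below.
\<close>

definition ulam_set :: "bool list set \<Rightarrow> bool list set" where
  "ulam_set G = (\<Union>k. (SOME S. ulam_run G S) k)"

lemma ulam_step_exists: "\<exists>B. ulam_step A B"
proof (cases "\<exists>u. ulam_candidate A u")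
  case True
  then obtain u where "ulam_candidate A u" "\<forall>w. ulam_candidate A w \<longrightarrow> length u \<le> length w"
    using ex_has_least_nat[of "ulam_candidate A" _ length] by blast
  then show ?thesis unfolding ulam_step_def by auto
qed (auto simp: ulam_step_def)

lemma ulam_run_exists: "\<exists>S. ulam_run G S"
proof -
  define S where "S = rec_nat G (\<lambda>_ A. SOME B. ulam_step A B)"
  have "ulam_step (S k) (S (Suc k))" for k
    using someI_ex[OF ulam_step_exists] by (simp add: S_def)
  then show ?thesis unfolding ulam_run_def by (intro exI[of _ S]) (simp add: S_def)
qed

context
  fixes S
  assumes run: "ulam_run {[False], [True]} S"
begin

private lemma S_0: "S 0 = {[False], [True]}"
  using run by (simp add: ulam_run_def)

private lemma step: "ulam_step (S k) (S (Suc k))"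
  using run by (simp add: ulam_run_def)

private lemma step_cases:
  obtains "\<And>w. \<not> ulam_candidate (S k) w" "S (Suc k) = S k"
  | u where "ulam_candidate (S k) u" "\<And>w. ulam_candidate (S k) w \<Longrightarrow> length u \<le> length w"
      "S (Suc k) = insert u (S k)"
  using step[of k] unfolding ulam_step_def by (auto split: if_splits)

private lemma S_mono: "j \<le> k \<Longrightarrow> S j \<subseteq> S k"
  by (rule lift_Suc_mono_le) (metis step_cases order_refl subset_insertI)

private lemma nonempty: "u \<in> S k \<Longrightarrow> u \<noteq> []"
proof (induction k arbitrary: u)
  case 0
  then show ?case by (auto simp: S_0)
next
  case (Suc k)
  show ?case
    by (rule step_cases[of k]) (use Suc in \<open>auto simp: ulam_candidate_def\<close>)
qed

private lemma candidate_length: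
  assumes "ulam_candidate (S k) w" shows "2 \<le> length w"
proof -
  obtain v x where "v \<in> S k" "x \<in> S k" "w = v @ x"
    using assms unfolding ulam_candidate_def by auto
  then show ?thesis using nonempty[of v k] nonempty[of x k] by (cases v; cases x; simp)
qed

private lemma length_le:
  "ulam_candidate (S k) w \<Longrightarrow> x \<in> S k \<Longrightarrow> length x \<le> length w"
proof (induction k arbitrary: w x)
  case 0
  have "length x = 1" using 0(2) by (auto simp: S_0)
  then show ?case using candidate_length[OF 0(1)] by simp
next
  case (Suc k)
  show ?case
  proof (rule step_cases[of k])
    fix u
    assume u: "ulam_candidate (S k) u" "\<And>w. ulam_candidate (S k) w \<Longrightarrow> length u \<le> length w"
      and eq: "S (Suc k) = insert u (S k)"
    have *: "length u \<le> length w"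
    proof (rule ccontr)
      assume less: "\<not> ?thesis"
      have "(fst p \<in> S (Suc k) \<and> snd p \<in> S (Suc k) \<and> fst p \<noteq> snd p \<and> w = fst p @ snd p) =
          (fst p \<in> S k \<and> snd p \<in> S k \<and> fst p \<noteq> snd p \<and> w = fst p @ snd p)" for p
        using less by (auto simp: eq)
      then have "ulam_candidate (S k) w"
        using Suc.prems(1) by (simp add: ulam_candidate_def eq)
      with u(2) less show False by blast
    qed
    show ?thesis using Suc.prems(2) Suc.IH[OF u(1)] * by (force simp: eq)
  qed (use Suc in auto)
qed

private lemma later_length:
  assumes "u \<in> S k" "x \<in> S j" "x \<notin> S k" shows "length u \<le> length x"
  using assms
proof (induction j)
  case 0
  then show ?case using S_mono[of 0 k] by auto
next
  case (Suc j)
  show ?case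
  proof (rule step_cases[of j])
    fix y
    assume y: "ulam_candidate (S j) y" and eq: "S (Suc j) = insert y (S j)"
    show ?thesis
    proof (cases "x \<in> S j")
      case False
      then have "x = y" using Suc.prems eq by auto
      moreover have "k \<le> j"
        using S_mono[of "Suc j" k] Suc.prems by (meson not_less_eq_eq subsetD)
      then have "u \<in> S j" using S_mono Suc.prems by blast
      ultimately show ?thesis using length_le y by blast
    qed (use Suc in auto)
  qed (use Suc in auto)
qed

private lemma run_length_1: "length u = 1 \<Longrightarrow> u \<in> (\<Union>k. S k)"
proof -
  assume "length u = 1"
  then have "u \<in> {[False], [True]}" by (cases u) auto
  then show ?thesis using S_0 by (metis UN_I UNIV_I)
qed

private abbreviation "rep A u p \<equiv>
  fst p \<in> A \<and> snd p \<in> A \<and> fst p \<noteq> snd p \<and> u = fst p @ snd p"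

private lemma run_iff:
  assumes len: "2 \<le> length u"
  shows "u \<in> (\<Union>k. S k) \<longleftrightarrow> (\<exists>!p. rep (\<Union>k. S k) u p)"
proof
  assume "u \<in> (\<Union>k. S k)"
  then obtain m' where m': "u \<in> S m'" by blast
  define m where "m = (LEAST k. u \<in> S k)"
  have m: "u \<in> S m" unfolding m_def by (rule LeastI[of "\<lambda>k. u \<in> S k", OF m'])
  have m_least: "u \<notin> S j" if "j < m" for j
    using not_less_Least[of j "\<lambda>k. u \<in> S k"] that unfolding m_def by simp
  have "m \<noteq> 0"
  proof
    assume "m = 0"
    with m have "u \<in> S 0" by simp
    then have "length u = 1" unfolding S_0 by auto
    with len show False by simp
  qed
  then obtain k where k: "m = Suc k" by (cases m) auto
  have new: "u \<in> S (Suc k)" "u \<notin> S k" using m m_least[of k] k by simp_all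
  have "ulam_candidate (S k) u \<and> S m = insert u (S k)"
    by (rule step_cases[of k]) (use new in \<open>auto simp: k\<close>)
  then have cand: "ulam_candidate (S k) u" and eq: "S m = insert u (S k)" by auto
  have "rep (\<Union>k. S k) u p = rep (S k) u p" for p
  proof
    assume p: "rep (\<Union>k. S k) u p"
    then have ne: "fst p \<noteq> []" "snd p \<noteq> []" using nonempty by auto
    have *: "x \<in> S k" if "x \<in> (\<Union>k. S k)" "length x < length u" for x
    proof -
      have "x \<in> S m" using that later_length[OF m] by (meson UN_E linorder_not_le)
      with that eq show ?thesis by auto
    qed
    have "length (fst p) < length u" "length (snd p) < length u" using p ne by auto
    with p * show "rep (S k) u p" by blast
  qed blast
  with cand show "\<exists>!p. rep (\<Union>k. S k) u p" by (simp add: ulam_candidate_def)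
next
  assume ex: "\<exists>!p. rep (\<Union>k. S k) u p"
  show "u \<in> (\<Union>k. S k)"
  proof (rule ccontr)
    assume nin: "u \<notin> (\<Union>k. S k)"
    obtain p where p: "rep (\<Union>k. S k) u p" using ex by blast
    then obtain a b where ab: "fst p \<in> S a" "snd p \<in> S b" by auto
    define k where "k = max a b"
    have cand: "ulam_candidate (S (k + j)) u" for j
    proof -
      have "a \<le> k + j" "b \<le> k + j" by (simp_all add: k_def)
      then have "fst p \<in> S (k + j)" "snd p \<in> S (k + j)" using ab S_mono by blast+
      with p have p': "rep (S (k + j)) u p" by blast
      have "q = p" if "rep (S (k + j)) u q" for q
      proof -
        have "rep (\<Union>k. S k) u q" using that by blast
        with ex p show ?thesis unfolding Ex1_def by metis
      qed
      moreover have "u \<notin> S (k + j)" using nin by blast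
      ultimately show ?thesis using p' unfolding ulam_candidate_def by (intro conjI[OF _ ex1I[of _ p]])
    qed
    define W where "W = {w :: bool list. set w \<subseteq> UNIV \<and> length w \<le> length u}"
    have fin: "finite W" unfolding W_def by (rule finite_lists_length_le) (rule finite)
    have sub: "S (k + j) \<subseteq> W" for j
      using length_le[OF cand] unfolding W_def by blast
    have le: "j \<le> card (S (k + j))" for j
    proof (induction j)
      case (Suc j)
      have finj: "finite (S (k + j))" using sub fin by (rule finite_subset)
      show ?case
      proof (rule step_cases[of "k + j"])
        fix w assume w: "ulam_candidate (S (k + j)) w"
          and eq: "S (Suc (k + j)) = insert w (S (k + j))"
        have "w \<notin> S (k + j)" using w by (simp add: ulam_candidate_def)
        then show ?thesis using Suc finj by (simp add: eq)
      qed (use cand in blast)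
    qed simp
    have "Suc (card W) \<le> card W"
      using le[of "Suc (card W)"] card_mono[OF fin sub, of "Suc (card W)"] by (rule order_trans)
    then show False by simp
  qed
qed

lemmas ulam_run_facts = nonempty run_length_1 run_iff

end

lemma ulam_runs_agree:
  assumes "ulam_run {[False], [True]} S" "ulam_run {[False], [True]} T"
  shows "u \<in> (\<Union>k. S k) \<longleftrightarrow> u \<in> (\<Union>k. T k)"
proof (induction "length u" arbitrary: u rule: less_induct)
  case less
  note S = ulam_run_facts[OF assms(1)] and T = ulam_run_facts[OF assms(2)]
  consider "u = []" | "length u = 1" | "2 \<le> length u"
    by (cases u) (auto simp: Suc_le_eq)
  then show ?case
  proof cases
    case 1
    with S(1) T(1) show ?thesis by blast
  next
    case 2
    from S(2)[OF 2] T(2)[OF 2] show ?thesis by simp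
  next
    case 3
    have "(fst p \<in> (\<Union>k. S k) \<and> snd p \<in> (\<Union>k. S k) \<and> fst p \<noteq> snd p \<and> u = fst p @ snd p) =
        (fst p \<in> (\<Union>k. T k) \<and> snd p \<in> (\<Union>k. T k) \<and> fst p \<noteq> snd p \<and> u = fst p @ snd p)" for p
    proof (cases "fst p \<noteq> [] \<and> snd p \<noteq> [] \<and> u = fst p @ snd p")
      case True
      then have "length (fst p) < length u" "length (snd p) < length u" by auto
      with less show ?thesis by blast
    next
      case False
      with S(1) T(1) show ?thesis by blast
    qed
    then show ?thesis unfolding S(3)[OF 3] T(3)[OF 3] by simp
  qed
qed

theorem ulam_run_Union:
  assumes "ulam_run {[False], [True]} S"
  shows "(\<Union>k. S k) = ulam_set {[False], [True]}"
  using ulam_runs_agree[OF assms someI_ex[OF ulam_run_exists]]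
  unfolding ulam_set_def by blast

theorem ulam_set_nonempty: "u \<in> ulam_set {[False], [True]} \<Longrightarrow> u \<in> words2"
  using ulam_run_facts(1)[OF someI_ex[OF ulam_run_exists]]
  unfolding ulam_set_def words2_def by blast

theorem ulam_set_length_1: "length u = 1 \<Longrightarrow> u \<in> ulam_set {[False], [True]}"
  using ulam_run_facts(2)[OF someI_ex[OF ulam_run_exists]]
  unfolding ulam_set_def by blast

theorem ulam_set_iff:
  assumes "2 \<le> length u"
  shows "u \<in> ulam_set {[False], [True]} \<longleftrightarrow>
    (\<exists>!p. fst p \<in> ulam_set {[False], [True]} \<and> snd p \<in> ulam_set {[False], [True]} \<and>
      fst p \<noteq> snd p \<and> u = fst p @ snd p)"
  using ulam_run_facts(3)[OF someI_ex[OF ulam_run_exists] assms]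
  unfolding ulam_set_def .

end

theory Submission
  imports Defs
begin

text \<open>
  Write \<open>one_word a b\<close> for the word with \<open>a\<close> zeros, then a 1, then \<open>b\<close> zeros. If such a word is cut
  in two, one of the pieces consists of zeros only, and the single letter 0 is the only word of that
  kind in the Ulam set (\<open>zeros_in_ulam_iff\<close>): a longer block of zeros could only arise from two equal
  words. So the only possible representations split off a single 0 at the left or at the right end.
  They are different, hence \<open>one_word a b\<close> belongs to the Ulam set iff exactly one of
  \<open>one_word (a - 1) b\<close> and \<open>one_word a (b - 1)\<close> does (\<open>one_word_in_ulam_iff_exactly_one\<close>). This
  exclusive or is Pascal's rule modulo 2, and induction along Pascal's triangle identifies
  membership with the parity of \<open>(a + b) choose a\<close>.
\<close>

abbreviation ulam01 :: "bool list set" where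
  "ulam01 \<equiv> ulam_set {[False], [True]}"

definition one_word :: "nat \<Rightarrow> nat \<Rightarrow> bool list" where
  "one_word a b = replicate a False @ True # replicate b False"

lemma Nil_notin_ulam: "[] \<notin> ulam01"
  using ulam_set_nonempty[of "[]"] by (auto simp: words2_def)

lemma append_eq_replicate:
  assumes "x @ y = replicate n c"
  shows "x = replicate (length x) c \<and> y = replicate (length y) c"
proof -
  have "set x \<union> set y \<subseteq> {c}" using arg_cong[OF assms, of set] by auto
  then have "\<forall>z\<in>set x. z = c" "\<forall>z\<in>set y. z = c" by blast+
  then show ?thesis by (simp only: replicate_length_same)
qed

text \<open>
  By strong induction both factors of a longer block of zeros are the letter 0, and a representation
  requires two different factors.
\<close>

lemma zeros_in_ulam_iff: "replicate k False \<in> ulam01 \<longleftrightarrow> k = 1"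
proof (induction k rule: less_induct)
  case (less k)
  consider "k = 0" | "k = 1" | "2 \<le> k" by linarith
  then show ?case
  proof cases
    case 1
    then show ?thesis using Nil_notin_ulam by simp
  next
    case 2
    then show ?thesis using ulam_set_length_1[of "[False]"] by simp
  next
    case 3
    have "v = w" if vw: "v \<in> ulam01" "w \<in> ulam01" "replicate k False = v @ w" for v w
    proof -
      from append_eq_replicate[OF vw(3)[symmetric]]
      obtain i j where rep: "v = replicate i False" "w = replicate j False" by blast
      with arg_cong[OF vw(3), of length] have "i + j = k" by simp
      moreover have "i \<noteq> 0" "j \<noteq> 0"
        using vw(1,2) Nil_notin_ulam unfolding rep by (auto intro: gr0I)
      ultimately have "i < k" "j < k" by simp_all
      then have "i = 1" "j = 1" using less.IH[of i] less.IH[of j] vw(1,2) unfolding rep by blast+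
      with rep show "v = w" by simp
    qed
    moreover have "2 \<le> length (replicate k False)" using 3 by simp
    ultimately have "replicate k False \<notin> ulam01" using ulam_set_iff by blast
    with 3 show ?thesis by simp
  qed
qed

lemma one_word_eq_append:
  assumes "one_word a b = x @ y"
  obtains k where "k \<le> a" "x = replicate k False" "y = one_word (a - k) b"
  | k where "k \<le> b" "x = one_word a (b - k)" "y = replicate k False"
proof (cases "length x \<le> a")
  case True
  from assms[symmetric] have "x = replicate (length x) False \<and> y = one_word (a - length x) b"
    unfolding append_eq_conv_conj one_word_def using True by simp
  with True that(1) show ?thesis by blast
next
  case False
  then obtain m where m: "length x = Suc (a + m)" using less_iff_Suc_add by (metis not_le)
  have "length x + length y = Suc (a + b)"
    using arg_cong[OF assms, of length] by (simp add: one_word_def)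
  with m have mb: "m \<le> b" by simp
  from assms[symmetric] have "x = one_word a m \<and> y = replicate (b - m) False"
    unfolding append_eq_conv_conj one_word_def using m mb by simp
  with mb that(2)[of "b - m"] show ?thesis by simp
qed

text \<open>
  One factor misses the 1, so it is a block of zeros, and such a block lies in the Ulam set only if
  it is the letter 0. The two factors differ automatically because only one of them contains a 1.
\<close>

lemma one_word_representations:
  "v \<in> ulam01 \<and> w \<in> ulam01 \<and> v \<noteq> w \<and> one_word a b = v @ w \<longleftrightarrow>
    (0 < a \<and> one_word (a - 1) b \<in> ulam01 \<and> v = [False] \<and> w = one_word (a - 1) b) \<or>
    (0 < b \<and> one_word a (b - 1) \<in> ulam01 \<and> v = one_word a (b - 1) \<and> w = [False])"
  (is "?L \<longleftrightarrow> ?R")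
proof
  assume L: ?L
  then have eq: "one_word a b = v @ w" by blast
  show ?R
  proof (rule one_word_eq_append[OF eq])
    fix k assume k: "k \<le> a" "v = replicate k False" "w = one_word (a - k) b"
    with L zeros_in_ulam_iff[of k] have "k = 1" by simp
    with k L show ?R by auto
  next
    fix k assume k: "k \<le> b" "v = one_word a (b - k)" "w = replicate k False"
    with L zeros_in_ulam_iff[of k] have "k = 1" by simp
    with k L show ?R by auto
  qed
next
  assume R: ?R
  have False_in: "[False] \<in> ulam01" by (simp add: ulam_set_length_1)
  have "True \<in> set (one_word c d)" for c d by (simp add: one_word_def)
  then have ne: "one_word c d \<noteq> [False]" for c d by (metis empty_set list.simps(15) singletonD)
  have left: "one_word a b = [False] @ one_word (a - 1) b" if "0 < a"
    using that by (cases a) (simp_all add: one_word_def)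
  have right: "one_word a b = one_word a (b - 1) @ [False]" if "0 < b"
    using that by (cases b) (simp_all add: one_word_def replicate_append_same)
  from R show ?L using False_in ne[of "a - 1" b] ne[of a "b - 1"] left right by metis
qed

text \<open>
  The two candidate pairs are different, since their first components have a different number of
  ones; so existence of a unique representation is an exclusive or.
\<close>

lemma one_word_in_ulam_iff_exactly_one:
  assumes "0 < a + b"
  shows "one_word a b \<in> ulam01 \<longleftrightarrow>
    (0 < a \<and> one_word (a - 1) b \<in> ulam01) \<noteq> (0 < b \<and> one_word a (b - 1) \<in> ulam01)"
proof -
  have "True \<in> set (one_word a (b - 1))" by (simp add: one_word_def)
  then have ne: "[False] \<noteq> one_word a (b - 1)" by (metis empty_set list.simps(15) singletonD)
  have len: "2 \<le> length (one_word a b)" using assms by (auto simp: one_word_def)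
  have "one_word a b \<in> ulam01 \<longleftrightarrow> (\<exists>!p.
      (0 < a \<and> one_word (a - 1) b \<in> ulam01 \<and> p = ([False], one_word (a - 1) b)) \<or>
      (0 < b \<and> one_word a (b - 1) \<in> ulam01 \<and> p = (one_word a (b - 1), [False])))"
    unfolding ulam_set_iff[OF len] one_word_representations prod_eq_iff fst_conv snd_conv ..
  also have "\<dots> \<longleftrightarrow>
      (0 < a \<and> one_word (a - 1) b \<in> ulam01) \<noteq> (0 < b \<and> one_word a (b - 1) \<in> ulam01)"
    using ne by blast
  finally show ?thesis .
qed

lemma one_word_in_ulam_iff: "one_word a b \<in> ulam01 \<longleftrightarrow> odd ((a + b) choose a)"
proof (induction "a + b" arbitrary: a b rule: less_induct)
  case less
  \<comment> \<open>On an edge of Pascal's triangle, below its apex, only one end of the word has a 0 to split off;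
    in the interior the exclusive or is matched with Pascal's rule.\<close>
  show ?case
  proof (cases a)
    case 0
    show ?thesis
    proof (cases b)
      case 0
      with \<open>a = 0\<close> show ?thesis by (simp add: one_word_def ulam_set_length_1)
    next
      case (Suc b')
      with \<open>a = 0\<close> show ?thesis
        using less[of 0 b'] one_word_in_ulam_iff_exactly_one[of 0 b] by simp
    qed
  next
    case (Suc a')
    show ?thesis
    proof (cases b)
      case 0
      with Suc show ?thesis
        using less[of a' 0] one_word_in_ulam_iff_exactly_one[of a 0] by simp
    next
      case (Suc b')
      with \<open>a = Suc a'\<close> show ?thesis
        using less[of a' b] less[of a b'] one_word_in_ulam_iff_exactly_one[of a b] by auto
    qed
  qed
qed

lemma eq_one_word:
  assumes "count_list u True = 1" "j < length u" "u ! j"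
  shows "u = one_word j (length u - Suc j)"
proof -
  have split: "u = take j u @ True # drop (Suc j) u"
    using id_take_nth_drop[OF assms(2)] assms(3) by simp
  have "count_list u True = count_list (take j u) True + Suc (count_list (drop (Suc j) u) True)"
    by (subst split) simp
  then have "True \<notin> set (take j u)" "True \<notin> set (drop (Suc j) u)"
    using assms(1) by (simp_all flip: count_list_0_iff)
  then have "\<forall>x\<in>set (take j u). x = False" "\<forall>x\<in>set (drop (Suc j) u). x = False"
    by metis+
  from this[THEN replicate_length_same]
  have "take j u = replicate j False" "drop (Suc j) u = replicate (length u - Suc j) False"
    using assms(2) by simp_all
  with split show ?thesis by (simp add: one_word_def)
qed

theorem theorem3p3:
  fixes u :: "bool list" and n i :: nat
  assumes "u \<in> words2"
    and "length u = n"
    and "count_list u True = 1"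
    and "1 \<le> i" and "i \<le> n" and "u ! (i - 1) = True"
  shows "u \<in> ulam_set {[False], [True]} \<longleftrightarrow> odd ((n - 1) choose (i - 1))"
proof -
  have "u = one_word (i - 1) (n - i)"
    using eq_one_word[of u "i - 1"] assms by simp
  moreover have "i - 1 + (n - i) = n - 1" using assms by simp
  ultimately show ?thesis using one_word_in_ulam_iff[of "i - 1" "n - i"] by simp
qed

end
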